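(* Let $(X,d)$ be a complete metric space and let $f:X\to[0,\infty]$ be proper and lower semicontinuous. Suppose that $x_0\in\mathrm{dom}(f)$ and $r>0$ satisfy Condition $(A')$ for some parameter function $\theta$. Suppose further that there exists $\bar\tau>0$ such that, for all $x\in B_r(x_0)\cap\{f\le f(x_0)\}$ and all $\tau\in(0,\bar\tau)$, the functional $$X\ni y\longmapsto f(y)+\frac1{2\tau}d(x,y)^2$$ has at least one global minimiser. Then for any step-size $\tau\in(0,\bar\tau)$ there exists an infinite proximal point sequence starting from $x_0$ with step-size $\tau$. Moreover, for any such sequence $(y_k)_{k=0}^\infty$ the following statements hold: (i) (confinement) $y_k\in B_r(x_0)$ for all $k\ge0$; (ii) (convergence) $y_\infty:=\lim_{k\to\infty}y_k$ exists and belongs to $B_r(x_0)$. Moreover, $f(y_\infty)=0$; (iii) (distance bound) for all $0\le i\le j<\infty$, $$d(y_i,y_j)\le\theta(f(y_i))-\theta(f(y_j))\qquad\text{and}\qquad d(y_i,y_\infty)\le\theta(f(y_i)).$$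
   Context: $B_r(x_0)$ is the open ball of radius $r$ around $x_0$. $\mathrm{dom}(f)=\{x: f(x)<\infty\}$, and $f$ is proper if $\mathrm{dom}(f)\ne\emptyset$. Slope: $|D^-f|(x):=\limsup_{y\to x}\frac{[f(y)-f(x)]_-}{d(y,x)}$ with $a_-=\max\{-a,0\}$; by convention $|D^-f|(x)=0$ if $x\in\mathrm{dom}(f)$ is isolated and $|D^-f|(x)=+\infty$ if $x\notin\mathrm{dom}(f)$. Parameter function: $\theta\in C([0,\infty))\cap C^1((0,\infty))$ with $\theta(0)=0$ and $\theta'(u)>0$ for $u>0$. Condition $(A')$ for $x_0\in\mathrm{dom}(f)$, $r>0$ with parameter function $\theta$: $\theta(f(x_0))<r$, and $\theta'(f(x))\cdot|D^-f|(x)\ge1$ for all $x\in B_r(x_0)$ with $0<f(x)\le f(x_0)$. A proximal point sequence starting from $x_0$ with step-size $\tau>0$ is a (finite or infinite) sequence $(y_k)$ in $X$ with $y_0=x_0$ and $y_{k+1}\in\arg\min_{x\in X}\{f(x)+\frac1{2\tau}d(y_k,x)^2\}$ for every $k$. *)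

theory Defs
  imports "HOL-Analysis.Analysis"
begin

definition edom :: "('a \<Rightarrow> ereal) \<Rightarrow> 'a set" where
  "edom f = {x. f x < \<infinity>}"

definition proper :: "('a \<Rightarrow> ereal) \<Rightarrow> bool" where
  "proper f \<longleftrightarrow> edom f \<noteq> {}"

(* Liminf over the punctured filter; at an isolated point it is \<infinity>, so the condition is void there. *)
definition lower_semicontinuous :: "('a::topological_space \<Rightarrow> ereal) \<Rightarrow> bool" where
  "lower_semicontinuous f \<longleftrightarrow> (\<forall>x. f x \<le> Liminf (at x) f)"

definition neg_part :: "ereal \<Rightarrow> ereal" where
  "neg_part a = max (- a) 0"

(* The isolated case is spelled out because the limit superior along the trivial filter
   is - \<infinity> in ereal. *)
definition descending_slope :: "('a::metric_space \<Rightarrow> ereal) \<Rightarrow> 'a \<Rightarrow> ereal" where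
  "descending_slope f x =
     (if x \<notin> edom f then \<infinity>
      else if \<not> x islimpt UNIV then 0
      else Limsup (at x) (\<lambda>y. neg_part (f y - f x) / ereal (dist y x)))"

(* theta lives on [0,\<infinity>); its values at negative arguments are irrelevant. *)
definition parameter_function :: "(real \<Rightarrow> real) \<Rightarrow> bool" where
  "parameter_function \<theta> \<longleftrightarrow>
     continuous_on {0..} \<theta> \<and> \<theta> differentiable_on {0<..} \<and> continuous_on {0<..} (deriv \<theta>) \<and>
     \<theta> 0 = 0 \<and> (\<forall>u>0. deriv \<theta> u > 0)"

(* Meant for x0 in edom f and f nonnegative, so that real_of_ereal is only applied to
   finite values. *)
definition condition_A' ::
  "('a::metric_space \<Rightarrow> ereal) \<Rightarrow> (real \<Rightarrow> real) \<Rightarrow> 'a \<Rightarrow> real \<Rightarrow> bool" where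
  "condition_A' f \<theta> x0 r \<longleftrightarrow>
     \<theta> (real_of_ereal (f x0)) < r \<and>
     (\<forall>x\<in>ball x0 r. 0 < f x \<and> f x \<le> f x0 \<longrightarrow>
        ereal (deriv \<theta> (real_of_ereal (f x))) * descending_slope f x \<ge> 1)"

definition prox_functional :: "('a::metric_space \<Rightarrow> ereal) \<Rightarrow> real \<Rightarrow> 'a \<Rightarrow> 'a \<Rightarrow> ereal" where
  "prox_functional f \<tau> x y = f y + ereal (1 / (2 * \<tau>) * (dist x y)\<^sup>2)"

definition is_prox_minimiser :: "('a::metric_space \<Rightarrow> ereal) \<Rightarrow> real \<Rightarrow> 'a \<Rightarrow> 'a \<Rightarrow> bool" where
  "is_prox_minimiser f \<tau> x z \<longleftrightarrow> is_arg_min (prox_functional f \<tau> x) (\<lambda>_. True) z"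

definition infinite_prox_seq ::
  "('a::metric_space \<Rightarrow> ereal) \<Rightarrow> real \<Rightarrow> 'a \<Rightarrow> (nat \<Rightarrow> 'a) \<Rightarrow> bool" where
  "infinite_prox_seq f \<tau> x0 y \<longleftrightarrow>
     y 0 = x0 \<and> (\<forall>k. is_prox_minimiser f \<tau> (y k) (y (Suc k)))"

end

theory Submission
  imports Defs
begin

text \<open>
  The heart of the argument is that a proximal step is a metric projection onto a sublevel set.
  If \<open>z\<close> minimises \<open>f v + dist x v ^ 2 / (2 * \<tau>)\<close> over \<open>v\<close>, then every \<open>w\<close> with \<open>f w \<le> f z\<close> satisfies
  \<open>dist x z \<le> dist x w\<close> (lemma \<open>prox_minimiser_nearest\<close>). So it suffices to bound the distance from
  \<open>x\<close> to \<open>{w. f w \<le> s}\<close> by \<open>\<theta> (f x) - \<theta> s\<close>, for \<open>s = f z\<close>. No convexity and no property of the slope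
  at \<open>z\<close> is involved.

  That bound is \<open>sublevel_error_bound\<close>, up to a factor \<open>K > 1\<close> that may be taken arbitrarily close
  to \<open>1\<close>. Ekeland's principle, applied to \<open>K * \<theta> (max (f v) s)\<close> on \<open>{v. f v \<le> f x}\<close>, yields a point
  \<open>w\<close> at the required distance from \<open>x\<close> with \<open>K * (\<theta> (f w) - \<theta> (f v)) < dist w v\<close> for all
  \<open>v \<noteq> w\<close> with \<open>s < f v \<le> f x\<close>. If \<open>f w > s\<close>, linearising \<open>\<theta>\<close> at \<open>f w\<close> would make
  \<open>\<theta>' (f w)\<close> times the slope at \<open>w\<close> smaller than \<open>1\<close>, against the slope condition;
  hence \<open>f w \<le> s\<close>.

  Summing the estimate over consecutive steps keeps the sequence within distance
  \<open>\<theta> (f x0) < r\<close> of \<open>x0\<close> and makes it Cauchy. Passing to the limit in the minimality of the iterates,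
  the limit \<open>l\<close> satisfies \<open>f l \<le> f v + dist l v ^ 2 / (2 * \<tau>)\<close> for all \<open>v\<close>, so the slope at \<open>l\<close> is \<open>0\<close>
  (lemma \<open>descending_slope_prox_limit\<close>), and the slope condition forces \<open>f l = 0\<close>.
\<close>

section \<open>Ekeland's variational principle\<close>

lemma dist_le_decrease_limits:
  fixes y :: "nat \<Rightarrow> 'a::complete_space" and \<phi> :: "nat \<Rightarrow> real"
  assumes d: "\<And>i j. i \<le> j \<Longrightarrow> dist (y i) (y j) \<le> \<phi> i - \<phi> j" and b: "\<And>i. b \<le> \<phi> i"
  obtains l m where "y \<longlonglongrightarrow> l" "\<phi> \<longlonglongrightarrow> m" "\<And>i. dist (y i) l \<le> \<phi> i - m" "b \<le> m"
proof -
  have "\<phi> j \<le> \<phi> i" if "i \<le> j" for i j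
    using d[OF that] zero_le_dist[of "y i" "y j"] by linarith
  then have "decseq \<phi>"
    by (simp add: decseq_def)
  with b obtain m where m: "\<phi> \<longlonglongrightarrow> m" "\<And>i. m \<le> \<phi> i"
    using decseq_convergent[of \<phi> b] by blast
  have "Cauchy y"
  proof (rule metric_CauchyI)
    fix e :: real assume "0 < e"
    then have "\<forall>\<^sub>F n in sequentially. \<phi> n < m + e"
      by (intro order_tendstoD(2)[OF m(1)]) simp
    then obtain M where M: "\<And>n. M \<le> n \<Longrightarrow> \<phi> n < m + e"
      by (auto simp: eventually_sequentially)
    have less: "dist (y i) (y j) < e" if "M \<le> i" "i \<le> j" for i j
      using d[OF that(2)] M[OF that(1)] m(2)[of j] by linarith
    have "dist (y i) (y j) < e" if "M \<le> i" "M \<le> j" for i j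
      using less[of i j] less[of j i] that by (cases "i \<le> j") (auto simp: dist_commute)
    then show "\<exists>M. \<forall>i\<ge>M. \<forall>j\<ge>M. dist (y i) (y j) < e"
      by blast
  qed
  then obtain l where l: "y \<longlonglongrightarrow> l"
    using Cauchy_convergent convergent_def by blast
  show thesis
  proof
    show "dist (y i) l \<le> \<phi> i - m" for i
      by (rule LIMSEQ_le[OF tendsto_dist[OF tendsto_const l] tendsto_diff[OF tendsto_const m(1)]])
        (use d in blast)
    show "b \<le> m"
      using LIMSEQ_le_const[OF m(1), of b] b by blast
  qed (use l m in auto)
qed

text \<open>
  Lower semicontinuity of \<open>g\<close> and closedness of \<open>S\<close> are assumed in one sequential condition,
  restricted to sequences along which \<open>g\<close> converges; the proof meets no others.
\<close>
lemma ekeland: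
  fixes g :: "'a::complete_space \<Rightarrow> real"
  assumes x: "x \<in> S" and bdd: "\<And>v. v \<in> S \<Longrightarrow> b \<le> g v"
    and lsc: "\<And>\<sigma> l m. (\<And>n. \<sigma> n \<in> S) \<Longrightarrow> \<sigma> \<longlonglongrightarrow> l \<Longrightarrow> (\<lambda>n. g (\<sigma> n)) \<longlonglongrightarrow> m \<Longrightarrow> l \<in> S \<and> g l \<le> m"
  obtains w where "w \<in> S" "dist x w \<le> g x - g w"
    "\<And>v. v \<in> S \<Longrightarrow> v \<noteq> w \<Longrightarrow> g w - g v < dist w v"
proof -
  \<comment> \<open>The points reachable from \<open>v\<close> at a cost covered by the decrease of \<open>g\<close>. Each \<open>\<sigma> (Suc n)\<close> below
    nearly minimises \<open>g\<close> over \<open>T (\<sigma> n)\<close>, so that these decreasing sets shrink to the limit of \<open>\<sigma>\<close>.\<close>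
  define T where "T v = {w \<in> S. dist v w \<le> g v - g w}" for v
  have T_self: "v \<in> T v" if "v \<in> S" for v
    using that by (simp add: T_def)
  have T_trans: "T w \<subseteq> T v" if "w \<in> T v" for v w
  proof
    fix u assume "u \<in> T w"
    with that show "u \<in> T v"
      using dist_triangle[of v u w] by (auto simp: T_def)
  qed
  have bb: "bdd_below (g ` T v)" for v
    using bdd by (intro bdd_belowI[of _ b]) (auto simp: T_def)
  have "\<exists>\<sigma>. \<sigma> 0 = x \<and> (\<forall>n. \<sigma> n \<in> S \<and> (\<sigma> (Suc n) \<in> T (\<sigma> n) \<and>
      (\<forall>u \<in> T (\<sigma> n). g (\<sigma> (Suc n)) \<le> g u + 1 / real (Suc n))))"
  proof -
    have step: "\<exists>w. w \<in> S \<and> (w \<in> T v \<and> (\<forall>u \<in> T v. g w \<le> g u + 1 / real (Suc n)))"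
      if "v \<in> S" for v n
    proof -
      have "\<exists>w \<in> T v. g w < Inf (g ` T v) + 1 / real (Suc n)"
        using cInf_lessD[of "g ` T v" "Inf (g ` T v) + 1 / real (Suc n)"] T_self[OF that]
        by auto
      then obtain w where w: "w \<in> T v" "g w < Inf (g ` T v) + 1 / real (Suc n)"
        by blast
      have "g w \<le> g u + 1 / real (Suc n)" if "u \<in> T v" for u
        using w(2) cINF_lower[OF bb that] by linarith
      with w(1) show ?thesis
        by (auto simp: T_def)
    qed
    have "\<exists>\<sigma>. \<forall>n. (\<sigma> n \<in> S \<and> (n = 0 \<longrightarrow> \<sigma> n = x)) \<and> (\<sigma> (Suc n) \<in> T (\<sigma> n) \<and>
        (\<forall>u \<in> T (\<sigma> n). g (\<sigma> (Suc n)) \<le> g u + 1 / real (Suc n)))"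
    proof (rule dependent_nat_choice)
      show "\<exists>v. v \<in> S \<and> (0 = 0 \<longrightarrow> v = x)"
        using x by blast
    qed (use step in blast)
    then show ?thesis
      by blast
  qed
  then obtain \<sigma> where s0: "\<sigma> 0 = x" and sS: "\<And>n. \<sigma> n \<in> S"
    and sT: "\<And>n. \<sigma> (Suc n) \<in> T (\<sigma> n)"
    and smin: "\<And>n u. u \<in> T (\<sigma> n) \<Longrightarrow> g (\<sigma> (Suc n)) \<le> g u + 1 / real (Suc n)"
    by blast
  have T_sub: "T (\<sigma> n) \<subseteq> T (\<sigma> m)" if "m \<le> n" for m n
    using that by (induction rule: dec_induct) (use T_trans[OF sT] in blast)+
  have d: "dist (\<sigma> m) (\<sigma> n) \<le> g (\<sigma> m) - g (\<sigma> n)" if "m \<le> n" for m n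
    using T_sub[OF that] T_self[OF sS[of n]] by (auto simp: T_def)
  obtain l m where l: "\<sigma> \<longlonglongrightarrow> l" and m: "(\<lambda>n. g (\<sigma> n)) \<longlonglongrightarrow> m"
    and dl: "\<And>n. dist (\<sigma> n) l \<le> g (\<sigma> n) - m"
    by (rule dist_le_decrease_limits[of \<sigma> "\<lambda>n. g (\<sigma> n)" b]) (use d bdd sS in auto)
  have "l \<in> S" "g l \<le> m"
    using lsc[OF sS l m] by auto
  then have lT: "l \<in> T (\<sigma> n)" for n
    using dl[of n] by (simp add: T_def)
  show thesis
  proof
    show "l \<in> S" "dist x l \<le> g x - g l"
      using lT[of 0] s0 by (auto simp: T_def)
    fix v assume v: "v \<in> S" "v \<noteq> l"
    show "g l - g v < dist l v"
    proof (rule ccontr)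
      assume "\<not> ?thesis"
      with v have "v \<in> T l"
        by (simp add: T_def)
      then have vT: "v \<in> T (\<sigma> n)" for n
        using T_trans[OF lT] by blast
      have "dist (\<sigma> (Suc n)) v \<le> 1 / real (Suc n)" for n
        using vT[of "Suc n"] smin[OF vT[of n]] by (simp add: T_def)
      then have "dist l v \<le> 0"
        by (intro LIMSEQ_le[OF tendsto_dist[OF LIMSEQ_Suc[OF l] tendsto_const]
              LIMSEQ_Suc[OF lim_1_over_n]]) auto
      with v show False
        by simp
    qed
  qed
qed

section \<open>Lower semicontinuity and the descending slope\<close>

lemma lower_semicontinuous_eventually:
  assumes "lower_semicontinuous f" "c < f x"
  shows "\<forall>\<^sub>F y in nhds x. c < f y"
proof -
  have "\<forall>\<^sub>F y in at x. c < f y"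
    using assms less_LiminfD[of c "at x" f] unfolding lower_semicontinuous_def
    by (meson less_le_trans)
  with assms(2) show ?thesis
    unfolding eventually_at_filter by (auto elim: eventually_mono)
qed

lemma lower_semicontinuous_compose_seq:
  fixes f :: "'a::topological_space \<Rightarrow> ereal" and h :: "real \<Rightarrow> real"
  assumes lsc: "lower_semicontinuous f" and nonneg: "\<And>x. 0 \<le> f x"
    and h: "continuous_on UNIV h" "mono h" and c: "c < \<infinity>"
    and \<sigma>: "\<And>n. f (\<sigma> n) \<le> c" "\<sigma> \<longlonglongrightarrow> l"
    and m: "(\<lambda>n. h (real_of_ereal (f (\<sigma> n)))) \<longlonglongrightarrow> m"
  shows "f l \<le> c \<and> h (real_of_ereal (f l)) \<le> m"
proof -
  have ev: "\<forall>\<^sub>F n in sequentially. a < f (\<sigma> n)" if "a < f l" for a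
    using lower_semicontinuous_eventually[OF lsc that] \<sigma>(2)
    by (rule eventually_compose_filterlim)
  have le: "f l \<le> c"
  proof (rule ccontr)
    assume "\<not> f l \<le> c"
    then have "\<forall>\<^sub>F n in sequentially. c < f (\<sigma> n)"
      by (intro ev) simp
    then show False
      using \<sigma>(1) by (auto simp: eventually_sequentially not_less[symmetric])
  qed
  then obtain p where p: "f l = ereal p"
    using nonneg[of l] c by (cases "f l") auto
  have below: "h u \<le> m" if "u < p" for u
  proof (rule tendsto_lowerbound[OF m])
    have "\<forall>\<^sub>F n in sequentially. ereal u < f (\<sigma> n)"
      using that p by (intro ev) simp
    then show "\<forall>\<^sub>F n in sequentially. h u \<le> h (real_of_ereal (f (\<sigma> n)))"
    proof eventually_elim
      case (elim n)
      with \<sigma>(1)[of n] c show ?case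
        by (intro monoD[OF h(2)]) (cases "f (\<sigma> n)"; auto)
    qed
  qed simp
  have "h p \<le> m"
  proof (rule tendsto_upperbound)
    show "(h \<longlongrightarrow> h p) (at_left p)"
      using h(1) tendsto_within_subset[where f = h and S = UNIV and T = "{..<p}"]
      by (simp add: continuous_on_def)
    show "\<forall>\<^sub>F u in at_left p. h u \<le> m"
      using below by (simp add: eventually_at_filter)
  qed simp
  with le p show ?thesis
    by simp
qed

text \<open>The constant \<open>c\<close> must not be negative, since the slope is \<open>0\<close> at isolated points.\<close>
lemma descending_slope_le:
  fixes f :: "'a::metric_space \<Rightarrow> ereal"
  assumes fx: "f x = ereal p" and c: "0 \<le> c"
    and ev: "\<forall>\<^sub>F y in at x. f x \<le> f y + ereal (c * dist y x)"
  shows "descending_slope f x \<le> ereal c"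
proof (cases "x islimpt UNIV")
  case True
  have "\<forall>\<^sub>F y in at x. y \<noteq> x"
    by (simp add: eventually_at_filter)
  with ev have "\<forall>\<^sub>F y in at x. neg_part (f y - f x) / ereal (dist y x) \<le> ereal c"
  proof eventually_elim
    case (elim y)
    show ?case
    proof (cases "f y")
      case (real q)
      have "neg_part (f y - f x) = ereal (max (p - q) 0)"
        using real fx by (simp add: neg_part_def zero_ereal_def)
      moreover have "max (p - q) 0 \<le> c * dist y x"
        using elim real fx c by simp
      ultimately show ?thesis
        using elim by (simp add: pos_divide_le_eq del: ereal_max)
    qed (use elim fx c in \<open>auto simp: neg_part_def\<close>)
  qed
  then show ?thesis
    using True fx by (auto simp: descending_slope_def edom_def intro: Limsup_bounded)
qed (use fx c in \<open>auto simp: descending_slope_def edom_def\<close>)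

section \<open>Distance to sublevel sets\<close>

lemma parameter_function_deriv:
  assumes "parameter_function \<theta>" "0 < u"
  shows "(\<theta> has_real_derivative deriv \<theta> u) (at u) \<and> 0 < deriv \<theta> u"
proof -
  have "\<theta> differentiable at u"
    using assms by (auto simp: parameter_function_def differentiable_on_eq_differentiable_at)
  then show ?thesis
    using assms by (auto simp: parameter_function_def DERIV_deriv_iff_real_differentiable)
qed

lemma parameter_function_mono:
  assumes "parameter_function \<theta>" "0 \<le> u" "u \<le> v"
  shows "\<theta> u \<le> \<theta> v"
proof (cases "u = v")
  case False
  have "\<theta> u < \<theta> v"
  proof (rule DERIV_pos_imp_increasing_open[of u v \<theta>])
    show "u < v"
      using False assms by simp
    show "\<exists>y. DERIV \<theta> t :> y \<and> 0 < y" if "u < t" "t < v" for t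
      using parameter_function_deriv[OF assms(1)] that assms
      by (meson order_le_less_trans)
    show "continuous_on {u..v} \<theta>"
      using assms by (auto simp: parameter_function_def intro: continuous_on_subset)
  qed
  then show ?thesis
    by simp
qed simp

text \<open>
  The point \<open>x\<close> lies almost as close to the sublevel set of \<open>s\<close> as the decrease of \<open>\<theta>\<close> from \<open>f x\<close> to \<open>s\<close>
  permits. The slope condition is needed only on a ball whose radius \<open>R\<close> exceeds that decrease.
\<close>
lemma sublevel_error_bound:
  fixes f :: "'a::complete_space \<Rightarrow> ereal"
  assumes nonneg: "\<And>x. 0 \<le> f x" and lsc: "lower_semicontinuous f"
    and param: "parameter_function \<theta>"
    and fx: "f x = ereal p" and s: "0 \<le> s" "s < p"
    and slope: "\<And>w. w \<in> ball x R \<Longrightarrow> ereal s < f w \<Longrightarrow> f w \<le> f x \<Longrightarrow>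
      ereal (deriv \<theta> (real_of_ereal (f w))) * descending_slope f w \<ge> 1"
    and K: "1 < K" "K * (\<theta> p - \<theta> s) < R"
  obtains w where "f w \<le> ereal s" "dist x w \<le> K * (\<theta> p - \<theta> s)"
proof -
  \<comment> \<open>Truncating at \<open>s\<close> charges nothing for the part of a descent that goes below \<open>s\<close>, and
    makes \<open>h\<close> continuous and monotone on all of the real line.\<close>
  define h where "h u = K * \<theta> (max u s)" for u
  define g where "g v = h (real_of_ereal (f v))" for v
  have h_mono: "mono h"
    unfolding h_def using K s parameter_function_mono[OF param]
    by (intro monoI mult_left_mono) auto
  have h_cont: "continuous_on UNIV h"
    unfolding h_def
  proof (intro continuous_on_mult_left continuous_on_compose2[of "{0..}" \<theta> UNIV "\<lambda>u. max u s"])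
    show "continuous_on {0..} \<theta>"
      using param by (simp add: parameter_function_def)
    show "continuous_on UNIV (\<lambda>u. max u s)"
      by (intro continuous_intros)
  qed (use s in auto)
  obtain w where w: "f w \<le> f x" "dist x w \<le> g x - g w"
    and w_min: "\<And>v. f v \<le> f x \<Longrightarrow> v \<noteq> w \<Longrightarrow> g w - g v < dist w v"
  proof (rule ekeland[of x "{v. f v \<le> f x}" "h s" g])
    show "h s \<le> g v" for v
      unfolding g_def h_def using K s parameter_function_mono[OF param]
      by (intro mult_left_mono) auto
    show "l \<in> {v. f v \<le> f x} \<and> g l \<le> m"
      if "\<And>n. \<sigma> n \<in> {v. f v \<le> f x}" "\<sigma> \<longlonglongrightarrow> l" "(\<lambda>n. g (\<sigma> n)) \<longlonglongrightarrow> m" for \<sigma> l m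
      using lower_semicontinuous_compose_seq[OF lsc nonneg h_cont h_mono, of "f x" \<sigma> l m] that fx
      by (simp add: g_def)
  qed auto
  obtain q where q: "f w = ereal q"
    using w(1) fx nonneg[of w] by (cases "f w") auto
  have gx: "g x = K * \<theta> p"
    using s fx by (simp add: g_def h_def max_absorb1)
  have "K * \<theta> s \<le> g w"
    unfolding g_def h_def using K s parameter_function_mono[OF param]
    by (intro mult_left_mono) auto
  then have dw: "dist x w \<le> K * (\<theta> p - \<theta> s)"
    using w(2) gx by (simp add: algebra_simps)
  have "q \<le> s"
  proof (rule ccontr)
    assume "\<not> q \<le> s"
    then have q_gt: "s < q" "0 < q"
      using s by auto
    define a where "a = deriv \<theta> q"
    have a: "0 < a" "(\<theta> has_real_derivative a) (at q)"
      using parameter_function_deriv[OF param q_gt(2)] by (auto simp: a_def)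
    \<comment> \<open>The slack \<open>k\<close> absorbs the error of linearising \<open>\<theta>\<close> at \<open>q\<close>; \<open>k < K\<close> leaves a contradiction.\<close>
    define k where "k = (1 + K) / 2"
    have k: "1 < k" "k < K"
      using K by (auto simp: k_def)
    have "\<forall>\<^sub>F u in at q. a / k < (\<theta> u - \<theta> q) / (u - q)"
      using a k by (intro order_tendstoD(1)[of _ a])
        (auto simp: has_field_derivative_iff divide_less_eq)
    then obtain \<delta> where \<delta>: "0 < \<delta>"
      and quot: "\<And>u. u \<noteq> q \<Longrightarrow> dist u q < \<delta> \<Longrightarrow> a / k < (\<theta> u - \<theta> q) / (u - q)"
      by (auto simp: eventually_at)
    \<comment> \<open>By lower semicontinuity, values near \<open>w\<close> drop neither to \<open>s\<close> nor out of the range where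
      the linearisation is valid.\<close>
    have "\<forall>\<^sub>F v in nhds w. ereal (max s (q - \<delta>)) < f v"
      using q_gt \<delta> q by (intro lower_semicontinuous_eventually[OF lsc]) auto
    then have "\<forall>\<^sub>F v in at w. ereal (max s (q - \<delta>)) < f v \<and> v \<noteq> w"
      unfolding eventually_at_filter by (rule eventually_mono) simp
    then have "\<forall>\<^sub>F v in at w. f w \<le> f v + ereal (k / (K * a) * dist v w)"
    proof eventually_elim
      case (elim v)
      show "f w \<le> f v + ereal (k / (K * a) * dist v w)"
      proof (cases "f v < f w")
        case True
        then obtain u where u: "f v = ereal u" "u < q"
          using q nonneg[of v] by (cases "f v") auto
        have "s < u" "dist u q < \<delta>"
          using elim u by (auto simp: dist_real_def)
        have "a / k < (\<theta> q - \<theta> u) / (q - u)"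
          using quot[of u] u \<open>dist u q < \<delta>\<close> minus_divide_divide[of "\<theta> q - \<theta> u" "q - u"] by simp
        then have "(q - u) * (a / k) \<le> \<theta> q - \<theta> u"
          using u by (simp add: less_divide_eq mult.commute)
        then have "K * ((q - u) * (a / k)) \<le> K * (\<theta> q - \<theta> u)"
          using K by (intro mult_left_mono) auto
        also have "\<dots> = g w - g v"
          using \<open>s < u\<close> q_gt u q by (simp add: g_def h_def max_absorb1 algebra_simps)
        also have "\<dots> < dist v w"
          using w_min[of v] True w(1) elim by (simp add: dist_commute)
        finally have "q - u \<le> k / (K * a) * dist v w"
          using K a k by (simp add: field_simps)
        then show ?thesis
          using u q by simp
      next
        case False
        have "0 \<le> k / (K * a) * dist v w"
          using K a k by simp
        with False show ?thesis
          by (intro add_increasing2[of _ "f w" "f v"]) auto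
      qed
    qed
    then have "descending_slope f w \<le> ereal (k / (K * a))"
      using q K a k by (intro descending_slope_le[where p = q]) auto
    then have "ereal a * descending_slope f w \<le> ereal a * ereal (k / (K * a))"
      using a by (intro ereal_mult_left_mono) auto
    also have "\<dots> < 1"
      using K a k by (simp add: one_ereal_def)
    also have "1 \<le> ereal a * descending_slope f w"
      using slope[of w] dw K q q_gt w(1) by (simp add: a_def)
    finally show False
      by simp
  qed
  then show thesis
    using that[of w] dw q by simp
qed

section \<open>Proximal steps\<close>

lemma is_prox_minimiserD:
  assumes "is_prox_minimiser f \<tau> x z"
  shows "f z + ereal (1 / (2 * \<tau>) * (dist x z)\<^sup>2) \<le> f v + ereal (1 / (2 * \<tau>) * (dist x v)\<^sup>2)"
  using assms by (auto simp: is_prox_minimiser_def is_arg_min_def prox_functional_def not_less)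

lemma prox_minimiser_le:
  assumes "is_prox_minimiser f \<tau> x z" "0 < \<tau>"
  shows "f z \<le> f x"
proof -
  have "f z \<le> f z + ereal (1 / (2 * \<tau>) * (dist x z)\<^sup>2)"
    using assms(2) by (intro add_increasing2) auto
  also have "\<dots> \<le> f x"
    using is_prox_minimiserD[OF assms(1), of x] by (simp flip: zero_ereal_def)
  finally show ?thesis .
qed

lemma prox_minimiser_nearest:
  assumes "is_prox_minimiser f \<tau> x z" "0 < \<tau>" "f z = ereal q" "f w \<le> f z"
  shows "dist x z \<le> dist x w"
proof -
  have "f z + ereal (1 / (2 * \<tau>) * (dist x z)\<^sup>2) \<le> f w + ereal (1 / (2 * \<tau>) * (dist x w)\<^sup>2)"
    by (rule is_prox_minimiserD[OF assms(1)])
  also have "\<dots> \<le> f z + ereal (1 / (2 * \<tau>) * (dist x w)\<^sup>2)"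
    using assms(4) by (rule add_right_mono)
  finally have "1 / (2 * \<tau>) * (dist x z)\<^sup>2 \<le> 1 / (2 * \<tau>) * (dist x w)\<^sup>2"
    using assms(3) by simp
  then have "(dist x z)\<^sup>2 \<le> (dist x w)\<^sup>2"
    using mult_le_cancel_left_pos[of "1 / (2 * \<tau>)"] assms(2) by simp
  then show ?thesis
    by (rule power2_le_imp_le) simp
qed

lemma prox_step_dist_le:
  fixes f :: "'a::complete_space \<Rightarrow> ereal"
  assumes nonneg: "\<And>x. 0 \<le> f x" and lsc: "lower_semicontinuous f"
    and param: "parameter_function \<theta>"
    and fx: "f x < \<infinity>" and R: "\<theta> (real_of_ereal (f x)) < R"
    and slope: "\<And>w. w \<in> ball x R \<Longrightarrow> 0 < f w \<Longrightarrow> f w \<le> f x \<Longrightarrow>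
      ereal (deriv \<theta> (real_of_ereal (f w))) * descending_slope f w \<ge> 1"
    and z: "is_prox_minimiser f \<tau> x z" "0 < \<tau>"
  shows "dist x z \<le> \<theta> (real_of_ereal (f x)) - \<theta> (real_of_ereal (f z))"
proof -
  obtain p where p: "f x = ereal p"
    using fx nonneg[of x] by (cases "f x") auto
  obtain s where s: "f z = ereal s" "s \<le> p"
    using prox_minimiser_le[OF z] p nonneg[of z] by (cases "f z") auto
  have s0: "0 \<le> s"
    using nonneg[of z] s by simp
  show ?thesis
  proof (cases "s = p")
    case True
    then show ?thesis
      using prox_minimiser_nearest[OF z s(1), of x] s p by simp
  next
    case False
    define D where "D = \<theta> p - \<theta> s"
    have "\<theta> 0 \<le> \<theta> s"
      using parameter_function_mono[OF param, of 0 s] s0 by simp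
    then have "D < R"
      using R p param by (simp add: D_def parameter_function_def)
    have bound: "dist x z \<le> K * D" if K: "1 < K" "K * D < R" for K
    proof -
      obtain w where "f w \<le> ereal s" "dist x w \<le> K * (\<theta> p - \<theta> s)"
      proof (rule sublevel_error_bound[OF nonneg lsc param p s0, of R K])
        show "s < p"
          using False s by simp
        show "1 \<le> ereal (deriv \<theta> (real_of_ereal (f w))) * descending_slope f w"
          if "w \<in> ball x R" "ereal s < f w" "f w \<le> f x" for w
          using slope[of w] that s0 by (meson ereal_less_eq(5) order_le_less_trans)
      qed (use K in \<open>auto simp: D_def\<close>)
      then show ?thesis
        using prox_minimiser_nearest[OF z s(1), of w] s by (auto simp: D_def)
    qed
    have lim: "((\<lambda>K. K * D) \<longlongrightarrow> 1 * D) (at_right 1)"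
      by (intro tendsto_intros)
    have "dist x z \<le> 1 * D"
    proof (rule tendsto_lowerbound[OF lim])
      have "\<forall>\<^sub>F K in at_right 1. K * D < R"
        using order_tendstoD(2)[OF lim] \<open>D < R\<close> by simp
      then show "\<forall>\<^sub>F K in at_right 1. dist x z \<le> K * D"
        using eventually_at_right_less[of "1::real"] by eventually_elim (use bound in auto)
    qed simp
    then show ?thesis
      using p s by (simp add: D_def)
  qed
qed

section \<open>Limits of proximal point sequences\<close>

lemma descending_slope_prox_limit:
  fixes f :: "'a::metric_space \<Rightarrow> ereal"
  assumes nonneg: "\<And>x. 0 \<le> f x" and lsc: "lower_semicontinuous f" and \<tau>: "0 < \<tau>"
    and y: "\<And>k. is_prox_minimiser f \<tau> (y k) (y (Suc k))" "y \<longlonglongrightarrow> l"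
    and fl: "f l < \<infinity>"
  shows "descending_slope f l \<le> 0"
proof -
  obtain p where p: "f l = ereal p"
    using fl nonneg[of l] by (cases "f l") auto
  have min: "f l \<le> f v + ereal (1 / (2 * \<tau>) * (dist l v)\<^sup>2)" for v
  proof (cases "f v")
    case (real q)
    have lim: "(\<lambda>k. q + 1 / (2 * \<tau>) * (dist (y k) v)\<^sup>2) \<longlonglongrightarrow> q + 1 / (2 * \<tau>) * (dist l v)\<^sup>2"
      by (intro tendsto_intros y(2))
    have "u \<le> q + 1 / (2 * \<tau>) * (dist l v)\<^sup>2" if "u < p" for u
    proof (rule tendsto_lowerbound[OF lim])
      have "\<forall>\<^sub>F k in sequentially. ereal u < f (y (Suc k))"
        using lower_semicontinuous_eventually[OF lsc, of "ereal u" l] LIMSEQ_Suc[OF y(2)] that p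
        by (intro eventually_compose_filterlim[where f = "\<lambda>k. y (Suc k)"]) auto
      then show "\<forall>\<^sub>F k in sequentially. u \<le> q + 1 / (2 * \<tau>) * (dist (y k) v)\<^sup>2"
      proof eventually_elim
        case (elim k)
        have "f (y (Suc k)) \<le> f (y (Suc k)) + ereal (1 / (2 * \<tau>) * (dist (y k) (y (Suc k)))\<^sup>2)"
          using \<tau> by (intro add_increasing2) auto
        also have "\<dots> \<le> ereal (q + 1 / (2 * \<tau>) * (dist (y k) v)\<^sup>2)"
          using is_prox_minimiserD[OF y(1), of k v] real by simp
        finally have "ereal u < \<dots>"
          using elim by (rule less_le_trans[rotated])
        then show ?case
          by simp
      qed
    qed simp
    then have "p \<le> q + 1 / (2 * \<tau>) * (dist l v)\<^sup>2"
      by (rule dense_le)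
    then show ?thesis
      using p real by simp
  qed (use nonneg[of v] in auto)
  have "descending_slope f l \<le> ereal c" if c: "0 < c" for c
  proof (rule descending_slope_le[of f l p])
    have "\<forall>\<^sub>F v in at l. dist v l < 2 * \<tau> * c"
      using \<tau> c unfolding eventually_at by (intro exI[of _ "2 * \<tau> * c"]) simp
    then show "\<forall>\<^sub>F v in at l. f l \<le> f v + ereal (c * dist v l)"
    proof eventually_elim
      case (elim v)
      have "1 / (2 * \<tau>) * (dist l v)\<^sup>2 = dist v l / (2 * \<tau>) * dist v l"
        by (simp add: power2_eq_square dist_commute)
      also have "\<dots> \<le> c * dist v l"
        using elim \<tau> by (intro mult_right_mono) (auto simp: divide_le_eq mult.commute)
      finally show ?case
        using min[of v] by (meson add_left_mono ereal_less_eq(3) order_trans)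
    qed
  qed (use c p in simp_all)
  then show ?thesis
    using ereal_dense2[of 0 "descending_slope f l"] by (force simp: not_le[symmetric])
qed

theorem theorem1p6:
  fixes f :: "'a::complete_space \<Rightarrow> ereal"
    and \<theta> :: "real \<Rightarrow> real"
    and x0 :: 'a
    and r \<tau>bar :: real
  assumes nonneg: "\<And>x. 0 \<le> f x"
    and proper: "proper f"
    and lsc: "lower_semicontinuous f"
    and x0_dom: "x0 \<in> edom f"
    and r_pos: "r > 0"
    and param: "parameter_function \<theta>"
    and condA': "condition_A' f \<theta> x0 r"
    and \<tau>bar_pos: "\<tau>bar > 0"
    and minimisers: "\<And>x \<tau>. x \<in> ball x0 r \<Longrightarrow> f x \<le> f x0 \<Longrightarrow> 0 < \<tau> \<Longrightarrow> \<tau> < \<tau>bar \<Longrightarrow>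
                       \<exists>z. is_prox_minimiser f \<tau> x z"
  shows "\<forall>\<tau>. 0 < \<tau> \<and> \<tau> < \<tau>bar \<longrightarrow>
    (\<exists>y. infinite_prox_seq f \<tau> x0 y) \<and>
    (\<forall>y. infinite_prox_seq f \<tau> x0 y \<longrightarrow>
       (\<forall>k. y k \<in> ball x0 r) \<and>
       (convergent y \<and> lim y \<in> ball x0 r \<and> f (lim y) = 0) \<and>
       (\<forall>i j. i \<le> j \<longrightarrow>
          dist (y i) (y j) \<le> \<theta> (real_of_ereal (f (y i))) - \<theta> (real_of_ereal (f (y j)))) \<and>
       (\<forall>i. dist (y i) (lim y) \<le> \<theta> (real_of_ereal (f (y i)))))"
proof -
  let ?\<phi> = "\<lambda>x. \<theta> (real_of_ereal (f x))"
  have \<phi>_nonneg: "0 \<le> ?\<phi> x" for x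
    using parameter_function_mono[OF param, of 0 "real_of_ereal (f x)"] nonneg[of x] param
    by (simp add: parameter_function_def real_of_ereal_pos)
  \<comment> \<open>The invariant of proximal steps. It implies membership in the ball, and it leaves room around
    \<open>x\<close> for a ball of radius larger than \<open>\<theta> (f x)\<close> on which the slope condition holds.\<close>
  define G where "G x \<longleftrightarrow> f x \<le> f x0 \<and> dist x0 x \<le> ?\<phi> x0 - ?\<phi> x" for x
  have G_ball: "x \<in> ball x0 r" if "G x" for x
    using that condA' \<phi>_nonneg[of x] by (simp add: G_def condition_A'_def)
  have G_x0: "G x0"
    by (simp add: G_def)
  have prox: "G z \<and> dist x z \<le> ?\<phi> x - ?\<phi> z"
    if x: "G x" and \<tau>: "0 < \<tau>" and z: "is_prox_minimiser f \<tau> x z" for \<tau> x z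
  proof -
    have d: "dist x z \<le> ?\<phi> x - ?\<phi> z"
    proof (rule prox_step_dist_le[OF nonneg lsc param _ _ _ z \<tau>, of "r - dist x0 x"])
      show "f x < \<infinity>"
        using x x0_dom by (auto simp: G_def edom_def)
      show "?\<phi> x < r - dist x0 x"
        using x condA' by (simp add: G_def condition_A'_def)
      show "1 \<le> ereal (deriv \<theta> (real_of_ereal (f w))) * descending_slope f w"
        if "w \<in> ball x (r - dist x0 x)" "0 < f w" "f w \<le> f x" for w
      proof -
        have "w \<in> ball x0 r"
          using that(1) dist_triangle[of x0 w x] by simp
        moreover have "f w \<le> f x0"
          using that(3) x by (auto simp: G_def)
        ultimately show ?thesis
          using condA' that(2) by (auto simp: condition_A'_def)
      qed
    qed
    moreover have "G z"
      using d x dist_triangle[of x0 z x] prox_minimiser_le[OF z \<tau>] by (auto simp: G_def)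
    ultimately show ?thesis
      by simp
  qed
  have ex: "\<exists>y. infinite_prox_seq f \<tau> x0 y" if \<tau>: "0 < \<tau>" "\<tau> < \<tau>bar" for \<tau>
  proof -
    have next_point: "\<exists>z. G z \<and> is_prox_minimiser f \<tau> x z" if "G x" for x
      using minimisers[OF G_ball[OF that] _ \<tau>] prox[OF that \<tau>(1)] that by (auto simp: G_def)
    have "\<exists>y. \<forall>n. (G (y n) \<and> (n = 0 \<longrightarrow> y n = x0)) \<and> is_prox_minimiser f \<tau> (y n) (y (Suc n))"
    proof (rule dependent_nat_choice)
      show "\<exists>v. G v \<and> (0 = 0 \<longrightarrow> v = x0)"
        using G_x0 by blast
    qed (use next_point in blast)
    then show ?thesis
      by (auto simp: infinite_prox_seq_def)
  qed
  have props: "(\<forall>k. y k \<in> ball x0 r) \<and>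
       (convergent y \<and> lim y \<in> ball x0 r \<and> f (lim y) = 0) \<and>
       (\<forall>i j. i \<le> j \<longrightarrow> dist (y i) (y j) \<le> ?\<phi> (y i) - ?\<phi> (y j)) \<and>
       (\<forall>i. dist (y i) (lim y) \<le> ?\<phi> (y i))"
    if \<tau>: "0 < \<tau>" and y: "infinite_prox_seq f \<tau> x0 y" for \<tau> y
  proof -
    have y0: "y 0 = x0" and yS: "is_prox_minimiser f \<tau> (y k) (y (Suc k))" for k
      using y by (auto simp: infinite_prox_seq_def)
    have G: "G (y k)" for k
      by (induction k) (use y0 G_x0 prox[OF _ \<tau> yS] in auto)
    have d: "dist (y i) (y j) \<le> ?\<phi> (y i) - ?\<phi> (y j)" if "i \<le> j" for i j
      using that
    proof (induction rule: dec_induct)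
      case (step n)
      then show ?case
        using prox[OF G[of n] \<tau> yS[of n]]
          dist_triangle[of "y i" "y (Suc n)" "y n"] by linarith
    qed simp
    obtain l m where l: "y \<longlonglongrightarrow> l" and dl: "\<And>i. dist (y i) l \<le> ?\<phi> (y i) - m" and "0 \<le> m"
      by (rule dist_le_decrease_limits[of y "\<lambda>i. ?\<phi> (y i)" 0]) (use d \<phi>_nonneg in auto)
    then have dl: "dist (y i) l \<le> ?\<phi> (y i)" for i
      using dl[of i] by linarith
    have lball: "l \<in> ball x0 r"
      using dl[of 0] y0 condA' by (simp add: condition_A'_def)
    have fl: "f l \<le> f x0"
    proof (rule ccontr)
      assume "\<not> f l \<le> f x0"
      then have "\<forall>\<^sub>F v in nhds l. f x0 < f v"
        by (intro lower_semicontinuous_eventually[OF lsc]) simp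
      then have "\<forall>\<^sub>F k in sequentially. f x0 < f (y k)"
        using l by (rule eventually_compose_filterlim)
      then show False
        using G by (auto simp: G_def eventually_sequentially not_less[symmetric])
    qed
    have "f l = 0"
    proof (rule ccontr)
      assume "f l \<noteq> 0"
      then have pos: "0 < f l"
        using nonneg[of l] by simp
      have fin: "f l < \<infinity>"
        using fl x0_dom by (auto simp: edom_def)
      then have "0 < real_of_ereal (f l)"
        using pos by (cases "f l") auto
      then have "0 \<le> deriv \<theta> (real_of_ereal (f l))"
        using parameter_function_deriv[OF param] by (simp add: less_imp_le)
      moreover have "descending_slope f l \<le> 0"
        by (rule descending_slope_prox_limit[OF nonneg lsc \<tau> yS l fin])
      ultimately have "ereal (deriv \<theta> (real_of_ereal (f l))) * descending_slope f l \<le> 0"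
        by (simp add: ereal_mult_le_0_iff)
      moreover have "1 \<le> ereal (deriv \<theta> (real_of_ereal (f l))) * descending_slope f l"
        using condA' lball pos fl by (auto simp: condition_A'_def)
      ultimately have "1 \<le> (0 :: ereal)"
        by (rule order_trans[rotated])
      then show False
        by simp
    qed
    moreover have "convergent y" "lim y = l"
      using l by (auto simp: convergent_def limI)
    ultimately show ?thesis
      using G_ball[OF G] d dl lball by auto
  qed
  show ?thesis
    using ex props by blast
qed

end
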